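(* Let $\mathcal{A}$ be a finite alphabet, let $\Omega_1,\Omega_2\subseteq\mathcal{A}^{\mathbb{N}}$ be subshifts and let $p_1,p_2\ge2$ be integers. The entropy of the axial product of $X_{\Omega_1}^{p_1}$ and $X_{\Omega_2}^{p_2}$ on the $2$-tree is $$h^T\left(X_{\Omega_1}^{p_1}\times X_{\Omega_2}^{p_2}\right)=\sum_{k=0}^\infty\ \sum_{\substack{i>1\\ p_1\nmid i}}\frac{1}{2^{k+i+1}}\log\left|\mathcal{P}\left(\Delta_k^{(i,1)},\Omega_1\times\Omega_2\right)\right|+\sum_{k=0}^\infty\ \sum_{\substack{j>1\\ p_2\nmid j}}\frac{1}{2^{k+j+1}}\log\left|\mathcal{P}\left(\Delta_k^{(1,j)},\Omega_1\times\Omega_2\right)\right|,$$ where $\Delta_k^{(i,1)}$ and $\Delta_k^{(1,j)}$ are taken with respect to the multiplicative constraints $p_1$ and $p_2$.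
   Context: $\mathbb{N}=\{1,2,\dots\}$. A subshift is a closed shift-invariant subset of $\mathcal{A}^{\mathbb{N}}$. The multiplicative subshift is $X_\Omega^p=\{x\in\mathcal{A}^{\mathbb{N}}:(x_{ip^l})_{l=0}^\infty\in\Omega\text{ for all }i\in\mathbb{N}\text{ with }p\nmid i\}$. $T^2$ is the free semigroup with unit $\epsilon$ generated by $f_1,f_2$; $|g|$ is the word length of $g\in T^2$, and $\Delta_n=\{g\in T^2:|g|\le n\}$. For $g\ne\epsilon$, $e(g)$ is the last letter of $g$ (for $g=\epsilon$ there is no last letter, so $f_i\neq e(\epsilon)$ for both $i$). Axial products on $T^2$: a sequence $(y_j)_{j\ge0}$ is regarded as an element of $\mathcal{A}^{\mathbb{N}}$ whose $(j+1)$-st entry is $y_j$. For multiplicative subshifts, $X_{\Omega_1}^{p_1}\times X_{\Omega_2}^{p_2}=\{x\in\mathcal{A}^{T^2}:\forall g\in T^2,\ \forall i\in\{1,2\}\text{ with }f_i\ne e(g),\ (x_{gf_i^j})_{j=0}^\infty\in X_{\Omega_i}^{p_i}\}$. For subshifts, $\Omega_1\times\Omega_2=\{x\in\mathcal{A}^{T^2}:\forall g\in T^2,\ \forall i\in\{1,2\},\ (x_{gf_i^j})_{j=0}^\infty\in\Omega_i\}$. For finite $\Lambda\subseteq T^2$ and $Z\subseteq\mathcal{A}^{T^2}$, $\mathcal{P}(\Lambda,Z)=\{(x_g)_{g\in\Lambda}:x\in Z\}$, and the entropy is $h^T(Z)=\lim_{n\to\infty}\frac{\log|\mathcal{P}(\Delta_n,Z)|}{|\Delta_n|}$.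 Types: for $g\in T^2$ and $m\in\{1,2\}$ let $\tau_m(g)=1+\max\{a\ge0: g\text{ ends in }f_m^a\}$; $g$ has type $(\tau_1(g),\tau_2(g))$ (at least one entry is $1$). Dependence sets: for $h\in T^2$ put $s_1(h)=hf_1^{(p_1-1)\tau_1(h)}$ and $s_2(h)=hf_2^{(p_2-1)\tau_2(h)}$ (i.e. passing from position $t$ to position $p_mt$ on the $f_m$-line through $h$). Let $g$ be a vertex of type $(i,j)$ (so $i=1$ or $j=1$) and $k\ge0$. The vertices of $g\Delta_k$ dependent on $g$ are the vertices $s_{u_n}\circ\cdots\circ s_{u_1}(g)$, $n\ge0$, $u_1,\dots,u_n\in\{1,2\}$, having length at most $|g|+k$. The reshaped set $\Delta_k^{(i,j)}\subseteq T^2$ is the set of all words $f_{u_1}\cdots f_{u_n}$ ($n\ge0$) such that $|s_{u_n}\circ\cdots\circ s_{u_1}(g)|\le|g|+k$; it depends only on $(i,j)$, $k$, $p_1$, $p_2$. *)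

theory Defs
  imports "HOL-Analysis.Analysis" "HOL-Library.Sublist"
begin

text \<open>Sequences indexed by \<open>{1, 2, \<dots>}\<close> are functions on \<^typ>\<open>nat\<close> whose value at \<open>n\<close> is the
  \<open>(n + 1)\<close>-st entry; the alphabet is a finite type with the discrete topology.\<close>

definition subshift :: "(nat \<Rightarrow> 'a) set \<Rightarrow> bool" where
  "subshift \<Omega> \<longleftrightarrow>
     closedin (product_topology (\<lambda>_. discrete_topology UNIV) UNIV) \<Omega> \<and>
     (\<forall>x\<in>\<Omega>. (\<lambda>n. x (Suc n)) \<in> \<Omega>)"

definition mult_subshift :: "nat \<Rightarrow> (nat \<Rightarrow> 'a) set \<Rightarrow> (nat \<Rightarrow> 'a) set" where
  "mult_subshift p \<Omega> = {x. \<forall>i\<ge>1. \<not> p dvd i \<longrightarrow> (\<lambda>l. x (i * p ^ l - 1)) \<in> \<Omega>}"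

text \<open>Elements of the free semigroup with unit on \<open>f\<^sub>1\<close>, \<open>f\<^sub>2\<close> are lists; the first letter of the word
  is the head of the list.\<close>

datatype gen = F1 | F2

definition axial_mult_product :: "(nat \<Rightarrow> 'a) set \<Rightarrow> (nat \<Rightarrow> 'a) set \<Rightarrow> (gen list \<Rightarrow> 'a) set" where
  "axial_mult_product X1 X2 =
     {x. \<forall>g m. (g = [] \<or> m \<noteq> last g) \<longrightarrow>
           (\<lambda>j. x (g @ replicate j m)) \<in> (case m of F1 \<Rightarrow> X1 | F2 \<Rightarrow> X2)}"

definition axial_product :: "(nat \<Rightarrow> 'a) set \<Rightarrow> (nat \<Rightarrow> 'a) set \<Rightarrow> (gen list \<Rightarrow> 'a) set" where
  "axial_product \<Omega>1 \<Omega>2 =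
     {x. \<forall>g m. (\<lambda>j. x (g @ replicate j m)) \<in> (case m of F1 \<Rightarrow> \<Omega>1 | F2 \<Rightarrow> \<Omega>2)}"

definition Delta :: "nat \<Rightarrow> gen list set" where
  "Delta n = {g. length g \<le> n}"

definition patterns :: "gen list set \<Rightarrow> (gen list \<Rightarrow> 'a) set \<Rightarrow> (gen list \<Rightarrow> 'a) set" where
  "patterns \<Lambda> Z = (\<lambda>x. restrict x \<Lambda>) ` Z"

text \<open>If \<open>Z\<close> is empty there are no patterns, and the library convention \<open>ln 0 = 0\<close> applies.\<close>

definition entropy_ratio :: "(gen list \<Rightarrow> 'a) set \<Rightarrow> nat \<Rightarrow> real" where
  "entropy_ratio Z n = ln (real (card (patterns (Delta n) Z))) / real (card (Delta n))"

definition tree_entropy :: "(gen list \<Rightarrow> 'a) set \<Rightarrow> real" where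
  "tree_entropy Z = lim (entropy_ratio Z)"

definition tau :: "gen \<Rightarrow> gen list \<Rightarrow> nat" where
  "tau m g = 1 + Max {a. suffix (replicate a m) g}"

definition vertex_type :: "gen list \<Rightarrow> nat \<times> nat" where
  "vertex_type g = (tau F1 g, tau F2 g)"

definition mult_step :: "nat \<Rightarrow> nat \<Rightarrow> gen \<Rightarrow> gen list \<Rightarrow> gen list" where
  "mult_step p1 p2 m h = h @ replicate (((case m of F1 \<Rightarrow> p1 | F2 \<Rightarrow> p2) - 1) * tau m h) m"

text \<open>\<^term>\<open>fold (mult_step p1 p2) [u\<^sub>1, u\<^sub>2] g\<close> applies the step for \<open>u\<^sub>1\<close> first.\<close>

definition reshaped_at :: "nat \<Rightarrow> nat \<Rightarrow> gen list \<Rightarrow> nat \<Rightarrow> gen list set" where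
  "reshaped_at p1 p2 g k = {w. length (fold (mult_step p1 p2) w g) \<le> length g + k}"

text \<open>The vertex \<open>g\<close> is arbitrary among those of the given type; lemma \<open>reshaped_eq\<close> shows that the
  set does not depend on it.\<close>

definition reshaped :: "nat \<Rightarrow> nat \<Rightarrow> nat \<times> nat \<Rightarrow> nat \<Rightarrow> gen list set" where
  "reshaped p1 p2 t k = reshaped_at p1 p2 (SOME g. vertex_type g = t) k"

lemma finite_suffix_replicate: "finite {a. suffix (replicate a m) g}"
  by (rule finite_subset[of _ "{..length g}"]) (auto dest: suffix_length_le)

lemma tau_snoc: "tau m (g @ [u]) = (if u = m then Suc (tau m g) else 1)"
proof (cases "u = m")
  have rs: "replicate (Suc b) m = replicate b m @ [m]" for b
    by (simp add: replicate_append_same)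
  case True
  have "{a. suffix (replicate a m) (g @ [m])} = insert 0 (Suc ` {a. suffix (replicate a m) g})"
  proof (rule set_eqI)
    fix a
    show "a \<in> {a. suffix (replicate a m) (g @ [m])} \<longleftrightarrow>
          a \<in> insert 0 (Suc ` {a. suffix (replicate a m) g})"
      by (cases a) (auto simp: rs simp del: replicate.simps(2))
  qed
  moreover have "Max (insert 0 (Suc ` {a. suffix (replicate a m) g})) =
      Suc (Max {a. suffix (replicate a m) g})"
  proof -
    have ne: "{a. suffix (replicate a m) g} \<noteq> {}"
      by (auto intro: exI[of _ 0])
    have "Suc (Max {a. suffix (replicate a m) g}) = Max (Suc ` {a. suffix (replicate a m) g})"
      by (rule mono_Max_commute) (use ne finite_suffix_replicate in \<open>auto simp: mono_def\<close>)
    then show ?thesis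
      using ne finite_suffix_replicate[of m g] by (subst Max_insert) auto
  qed
  ultimately show ?thesis using True by (simp add: tau_def)
next
  have rs: "replicate (Suc b) m = replicate b m @ [m]" for b
    by (simp add: replicate_append_same)
  case False
  have "{a. suffix (replicate a m) (g @ [u])} = {0}"
  proof (rule set_eqI)
    fix a
    show "a \<in> {a. suffix (replicate a m) (g @ [u])} \<longleftrightarrow> a \<in> {0}"
      using False by (cases a) (auto simp: rs simp del: replicate.simps(2))
  qed
  then show ?thesis using False by (simp add: tau_def)
qed

lemma tau_append_cong: "tau m g = tau m g' \<Longrightarrow> tau m (g @ w) = tau m (g' @ w)"
  by (induction w rule: rev_induct) (simp_all add: tau_snoc flip: append_assoc)

lemma fold_mult_step_cong:
  assumes "vertex_type g = vertex_type g'"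
  shows "\<exists>v. fold (mult_step p1 p2) w g = g @ v \<and> fold (mult_step p1 p2) w g' = g' @ v"
  using assms
proof (induction w arbitrary: g g')
  case Nil
  then show ?case by auto
next
  case (Cons u w)
  then have t: "tau m g = tau m g'" for m
    by (cases m) (auto simp: vertex_type_def)
  define r where "r = replicate (((case u of F1 \<Rightarrow> p1 | F2 \<Rightarrow> p2) - 1) * tau u g) u"
  have "mult_step p1 p2 u g = g @ r" "mult_step p1 p2 u g' = g' @ r"
    using t[of u] by (simp_all add: mult_step_def r_def)
  moreover have "vertex_type (g @ r) = vertex_type (g' @ r)"
    using t by (auto simp: vertex_type_def intro: tau_append_cong)
  ultimately show ?case using Cons.IH[of "g @ r" "g' @ r"] by auto
qed

lemma reshaped_eq: "reshaped p1 p2 (vertex_type g) k = reshaped_at p1 p2 g k"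
proof -
  define g' where "g' = (SOME g'. vertex_type g' = vertex_type g)"
  have "vertex_type g' = vertex_type g"
    unfolding g'_def by (rule someI) (rule refl)
  then have "length (fold (mult_step p1 p2) w g') \<le> length g' + k \<longleftrightarrow>
      length (fold (mult_step p1 p2) w g) \<le> length g + k" for w
    using fold_mult_step_cong[of g' g p1 p2 w] by auto
  then show ?thesis
    by (simp add: reshaped_def reshaped_at_def g'_def)
qed

end

theory Submission
  imports Defs "HOL-Real_Asymp.Real_Asymp"
begin

text \<open>The two steps \<open>s\<^sub>1\<close>, \<open>s\<^sub>2\<close> are injective with disjoint ranges, so the tree splits into free
  orbits, one for each root, i.e. each vertex with \<open>p\<^sub>m\<close> not dividing \<open>\<tau>\<^sub>m\<close> for both \<open>m\<close>. A point
  lies in the multiplicative product iff its restriction to every orbit lies in \<open>\<Omega>\<^sub>1 \<times> \<Omega>\<^sub>2\<close>, so the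
  number of patterns on \<open>\<Delta>\<^sub>n\<close> is a product over the roots in \<open>\<Delta>\<^sub>n\<close>. There are
  \<open>2\<^bsup>n-k-i\<^esup>\<close> vertices of length \<open>n - k\<close> and type \<open>(i, 1)\<close> if \<open>k + i \<le> n\<close>, and one if
  \<open>k + i = n + 1\<close>; the contribution of the latter and of the root \<open>\<epsilon>\<close> is negligible. All series are
  dominated by those of the reshaped sets' sizes, whose convergence comes for free: the orbits
  fill \<open>\<Delta>\<^sub>n\<close>, so the weighted sizes add up to at most \<open>1\<close>.\<close>

subsection \<open>Words and their types\<close>

instance gen :: finite
proof (standard, rule finite_subset)
  show "(UNIV :: gen set) \<subseteq> {F1, F2}" by (auto intro: gen.exhaust)
qed simp

lemma UNIV_gen: "(UNIV :: gen set) = {F1, F2}"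
  by (auto intro: gen.exhaust)

lemma ex_other_gen: "\<exists>u. \<forall>v. v \<noteq> m \<longleftrightarrow> v = (u :: gen)"
  by (metis gen.distinct(1) gen.exhaust)

lemma card_words: "card {g :: gen list. length g = n} = 2 ^ n"
proof -
  have "card (UNIV :: gen set) = 2" by (simp add: UNIV_gen)
  then show ?thesis using card_lists_length_eq[of "UNIV :: gen set" n] by simp
qed

lemma finite_words: "finite {g :: gen list. length g = n}"
  using finite_lists_length_eq[of "UNIV :: gen set" n] by simp

lemma finite_Delta: "finite (Delta n)"
  unfolding Delta_def using finite_lists_length_le[of "UNIV :: gen set" n] by simp

lemma card_Delta: "real (card (Delta n)) = 2 ^ (n + 1) - 1"
proof (induction n)
  case 0
  have "Delta 0 = {[]}" by (auto simp: Delta_def)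
  then show ?case by simp
next
  case (Suc n)
  have "Delta (Suc n) = Delta n \<union> {g. length g = Suc n}"
    by (auto simp: Delta_def)
  moreover have "Delta n \<inter> {g. length g = Suc n} = {}"
    by (auto simp: Delta_def)
  ultimately have "card (Delta (Suc n)) = card (Delta n) + 2 ^ Suc n"
    by (simp only: card_Un_disjoint[OF finite_Delta finite_words] card_words)
  then show ?case using Suc.IH by simp
qed

lemma tau_Nil [simp]: "tau m [] = 1"
proof -
  have "{a. suffix (replicate a m) []} = {0}" by auto
  then show ?thesis by (simp add: tau_def)
qed

lemma tau_pos: "0 < tau m g"
  by (simp add: tau_def)

lemma tau_append_replicate: "tau m (g @ replicate n m) = tau m g + n"
proof (induction n)
  case (Suc n)
  have "g @ replicate (Suc n) m = (g @ replicate n m) @ [m]"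
    by (simp add: replicate_append_same)
  then show ?case using Suc.IH by (simp only: tau_snoc) simp
qed simp

lemma tau_append_replicate_other:
  assumes "u \<noteq> m" "0 < n"
  shows "tau u (g @ replicate n m) = 1"
proof -
  obtain n' where "n = Suc n'" using assms(2) gr0_implies_Suc by blast
  then have "g @ replicate n m = (g @ replicate n' m) @ [m]"
    by (simp add: replicate_append_same)
  then show ?thesis using assms(1) by (simp only: tau_snoc) simp
qed

lemma tau_eq_1_iff: "tau m g = 1 \<longleftrightarrow> g = [] \<or> m \<noteq> last g"
  by (cases g rule: rev_cases) (use tau_pos in \<open>auto simp: tau_snoc\<close>)

text \<open>A nonempty word has a single last letter, so only one generator can have a nontrivial
  power as a suffix.\<close>

lemma tau_other:
  assumes "tau m g \<noteq> 1" "u \<noteq> m"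
  shows "tau u g = 1"
  using assms by (metis tau_eq_1_iff)

text \<open>\<open>v\<close> is the start of the line in direction \<open>m\<close> through
  \<open>g\<close>, and \<open>tau m g\<close> is the position of \<open>g\<close> on it, counted
  from 1. This coordinate links vertices to the indices of a multiplicative subshift.\<close>

lemma tau_decomp:
  obtains v where "g = v @ replicate (tau m g - 1) m" "v = [] \<or> m \<noteq> last v"
proof -
  have "\<exists>v. g = v @ replicate (tau m g - 1) m \<and> (v = [] \<or> m \<noteq> last v)"
  proof (induction g rule: rev_induct)
    case (snoc u g)
    show ?case
    proof (cases "u = m")
      case True
      obtain v where v: "g = v @ replicate (tau m g - 1) m" "v = [] \<or> m \<noteq> last v"
        using snoc.IH by blast
      have "Suc (tau m g - 1) = tau m g" using tau_pos[of m g] by simp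
      then have "replicate (tau m g) m = replicate (tau m g - 1) m @ [m]"
        by (metis replicate_Suc replicate_append_same)
      then have "g @ [u] = v @ replicate (tau m (g @ [u]) - 1) m"
        using v(1) True by (simp add: tau_snoc)
      then show ?thesis using v(2) by blast
    qed (auto simp: tau_snoc)
  qed simp
  then show ?thesis using that by blast
qed

text \<open>Such a word is some \<open>v\<close> not ending in \<open>m\<close>, followed by
  \<open>i - 1\<close> letters \<open>m\<close>. Either \<open>v\<close> is empty, or its last
  letter is forced and the remaining \<open>l - i\<close> letters are free.\<close>

lemma card_words_tau:
  assumes "1 \<le> i"
  shows "card {g. length g = l \<and> tau m g = i} =
    (if l + 1 < i then 0 else if l + 1 = i then 1 else 2 ^ (l - i))"
  using assms
proof (induction l arbitrary: i)
  case 0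
  have "{g. length g = 0 \<and> tau m g = i} = (if i = 1 then {[]} else {})" by auto
  then show ?case using 0 by auto
next
  case (Suc l)
  show ?case
  proof (cases "i = 1")
    case True
    obtain u where u: "\<And>v. v \<noteq> m \<longleftrightarrow> v = u" using ex_other_gen by metis
    then have "u \<noteq> m" by blast
    have "{g. length g = Suc l \<and> tau m g = i} = (\<lambda>g. g @ [u]) ` {g. length g = l}"
    proof (intro set_eqI iffI)
      fix g assume g: "g \<in> {g. length g = Suc l \<and> tau m g = i}"
      then obtain g' v where g': "g = g' @ [v]" by (cases g rule: rev_cases) auto
      then have "v \<noteq> m" "length g' = l"
        using g tau_pos[of m g'] True by (auto simp: tau_snoc)
      then show "g \<in> (\<lambda>g. g @ [u]) ` {g. length g = l}" using u g' by blast
    qed (use \<open>u \<noteq> m\<close> True in \<open>auto simp: tau_snoc\<close>)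
    moreover have "inj_on (\<lambda>g. g @ [u]) {g. length g = l}" by (auto simp: inj_on_def)
    ultimately show ?thesis using True by (simp add: card_image card_words)
  next
    case False
    then obtain j where j: "i = Suc j" "1 \<le> j" using Suc.prems by (cases i) auto
    have "{g. length g = Suc l \<and> tau m g = i} =
      (\<lambda>g. g @ [m]) ` {g. length g = l \<and> tau m g = j}"
    proof (intro set_eqI iffI)
      fix g assume g: "g \<in> {g. length g = Suc l \<and> tau m g = i}"
      then obtain g' v where "g = g' @ [v]" by (cases g rule: rev_cases) auto
      then show "g \<in> (\<lambda>g. g @ [m]) ` {g. length g = l \<and> tau m g = j}"
        using g j by (auto simp: tau_snoc split: if_splits)
    qed (use j in \<open>auto simp: tau_snoc\<close>)
    moreover have "inj_on (\<lambda>g. g @ [m]) {g. length g = l \<and> tau m g = j}"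
      by (auto simp: inj_on_def)
    ultimately show ?thesis using Suc.IH[OF j(2)] j(1) by (simp add: card_image)
  qed
qed

text \<open>A common name for the types \<open>(i, 1)\<close> and \<open>(1, i)\<close>, so that one
  argument with parameter \<open>m\<close> serves both double series.\<close>

definition axis_type :: "gen \<Rightarrow> nat \<Rightarrow> nat \<times> nat" where
  "axis_type m i = (case m of F1 \<Rightarrow> (i, 1) | F2 \<Rightarrow> (1, i))"

lemma vertex_type_axis:
  assumes "tau m g \<noteq> 1"
  shows "vertex_type g = axis_type m (tau m g)"
  using tau_other[OF assms] by (cases m) (auto simp: vertex_type_def axis_type_def)

lemma vertex_type_eqI: "(\<And>m. tau m g = tau m h) \<Longrightarrow> vertex_type g = vertex_type h"
  by (simp add: vertex_type_def)

section \<open>Bounds on the number of patterns\<close>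

lemma finite_patterns:
  assumes "finite \<Lambda>"
  shows "finite (patterns \<Lambda> (Z :: (gen list \<Rightarrow> 'a::finite) set))"
    and "card (patterns \<Lambda> Z) \<le> CARD('a) ^ card \<Lambda>"
proof -
  have sub: "patterns \<Lambda> Z \<subseteq> (\<Pi>\<^sub>E g\<in>\<Lambda>. UNIV)" by (auto simp: patterns_def)
  have fin: "finite (\<Pi>\<^sub>E g\<in>\<Lambda>. (UNIV :: 'a set))" using assms by (simp add: finite_PiE)
  show "finite (patterns \<Lambda> Z)" using finite_subset[OF sub fin] .
  show "card (patterns \<Lambda> Z) \<le> CARD('a) ^ card \<Lambda>"
    using card_mono[OF fin sub] assms by (simp add: card_PiE)
qed

text \<open>The bound by the number of all colourings of \<Lambda>; it lets the sizes of the
  reshaped sets dominate the logarithms. The convention \<open>ln 0 = 0\<close> covers an empty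
  \<open>Z\<close>.\<close>

lemma ln_card_patterns_le:
  fixes Z :: "(gen list \<Rightarrow> 'a::finite) set"
  assumes "finite \<Lambda>"
  shows "0 \<le> ln (real (card (patterns \<Lambda> Z)))"
    and "ln (real (card (patterns \<Lambda> Z))) \<le> ln (real CARD('a)) * real (card \<Lambda>)"
proof -
  have "0 \<le> ln (real n)" for n by (cases n) auto
  then show "0 \<le> ln (real (card (patterns \<Lambda> Z)))" .
  have A: "1 \<le> real CARD('a)" by (simp add: Suc_leI)
  show "ln (real (card (patterns \<Lambda> Z))) \<le> ln (real CARD('a)) * real (card \<Lambda>)"
  proof (cases "card (patterns \<Lambda> Z) = 0")
    case False
    have "real (card (patterns \<Lambda> Z)) \<le> real CARD('a) ^ card \<Lambda>"
      using finite_patterns(2)[OF assms, of Z] by (metis of_nat_le_iff of_nat_power)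
    then have "ln (real (card (patterns \<Lambda> Z))) \<le> ln (real CARD('a) ^ card \<Lambda>)"
      using False by (subst ln_le_cancel_iff) auto
    then show ?thesis by (simp add: ln_realpow mult.commute)
  qed (use A in simp)
qed

subsection \<open>Triangular partial sums of double series\<close>

definition triangle :: "nat set \<Rightarrow> nat \<Rightarrow> (nat \<times> nat) set" where
  "triangle I n = {(k, i). i \<in> I \<and> k + i \<le> n}"

lemma finite_triangle: "finite (triangle I n)"
  by (rule finite_subset[of _ "{..n} \<times> {..n}"]) (auto simp: triangle_def)

lemma triangle_subset: "triangle I n \<subseteq> UNIV \<times> I"
  by (auto simp: triangle_def)

lemma finite_subset_triangle:
  fixes F :: "(nat \<times> nat) set"
  assumes "finite F" "F \<subseteq> UNIV \<times> I"
  shows "\<exists>n. \<forall>m\<ge>n. F \<subseteq> triangle I m"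
proof -
  \<comment> \<open>Inserting 0 keeps the maximum meaningful when \<open>F\<close> is empty.\<close>
  define n where "n = Max (insert 0 ((\<lambda>(k, i). k + i) ` F))"
  have "k + i \<le> n" if "(k, i) \<in> F" for k i
    unfolding n_def using that assms(1) by (intro Max_ge) (auto intro: image_eqI[of _ _ "(k, i)"])
  then have "F \<subseteq> triangle I m" if "n \<le> m" for m
    using that assms(2) by (fastforce simp: triangle_def)
  then show ?thesis by blast
qed

text \<open>Every finite subset of \<open>UNIV \<times> I\<close> lies in all large triangles, so
  the triangles converge along the filter that defines unordered sums.\<close>

lemma triangle_sums_tendsto:
  fixes f :: "nat \<times> nat \<Rightarrow> real"
  assumes "f summable_on UNIV \<times> I"
  shows "(\<lambda>n. sum f (triangle I n)) \<longlonglongrightarrow> infsum f (UNIV \<times> I)"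
proof -
  have "filterlim (triangle I) (finite_subsets_at_top (UNIV \<times> I)) sequentially"
    unfolding filterlim_iff eventually_finite_subsets_at_top
  proof (intro allI impI)
    fix P :: "(nat \<times> nat) set \<Rightarrow> bool"
    assume "\<exists>X. finite X \<and> X \<subseteq> UNIV \<times> I \<and>
      (\<forall>Y. finite Y \<and> X \<subseteq> Y \<and> Y \<subseteq> UNIV \<times> I \<longrightarrow> P Y)"
    then obtain X where X: "finite X" "X \<subseteq> UNIV \<times> I"
      and P: "\<forall>Y. finite Y \<and> X \<subseteq> Y \<and> Y \<subseteq> UNIV \<times> I \<longrightarrow> P Y" by (elim exE conjE)
    obtain n where "\<forall>m\<ge>n. X \<subseteq> triangle I m"
      using finite_subset_triangle[OF X] by (elim exE)
    then show "eventually (\<lambda>n. P (triangle I n)) sequentially"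
      unfolding eventually_sequentially using P finite_triangle triangle_subset by metis
  qed
  moreover have "(sum f \<longlongrightarrow> infsum f (UNIV \<times> I)) (finite_subsets_at_top (UNIV \<times> I))"
    using assms has_sum_infsum by (simp add: has_sum_def)
  ultimately show ?thesis by (rule filterlim_compose[rotated])
qed

text \<open>The triangles are cofinal among the finite index sets, so for nonnegative terms a bound
  on triangular sums bounds all finite sums.\<close>

lemma triangle_sums_bounded_summable:
  fixes f :: "nat \<times> nat \<Rightarrow> real"
  assumes "\<And>z. 0 \<le> f z" "\<And>n. sum f (triangle I n) \<le> B"
  shows "f summable_on UNIV \<times> I"
proof (rule nonneg_bdd_above_summable_on)
  show "bdd_above (sum f ` {F. F \<subseteq> UNIV \<times> I \<and> finite F})"
  proof (rule bdd_aboveI2)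
    fix F :: "(nat \<times> nat) set"
    assume "F \<in> {F. F \<subseteq> UNIV \<times> I \<and> finite F}"
    then have "finite F" "F \<subseteq> UNIV \<times> I" by simp_all
    then obtain n where "F \<subseteq> triangle I n"
      using finite_subset_triangle by (meson order_refl)
    then have "sum f F \<le> sum f (triangle I n)"
      using assms(1) finite_triangle by (intro sum_mono2) auto
    then show "sum f F \<le> B" using assms(2)[of n] by linarith
  qed
qed (use assms in auto)

text \<open>Fubini for unordered sums, giving the iterated form in which the theorem states its
  series.\<close>

lemma summable_iterated:
  fixes f :: "nat \<times> nat \<Rightarrow> real"
  assumes "f summable_on UNIV \<times> I"
  shows "\<forall>k. (\<lambda>i. f (k, i)) summable_on I"
    and "summable (\<lambda>k. \<Sum>\<^sub>\<infinity>i\<in>I. f (k, i))"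
    and "infsum f (UNIV \<times> I) = (\<Sum>k. \<Sum>\<^sub>\<infinity>i\<in>I. f (k, i))"
proof -
  have f: "(\<lambda>(k, i). f (k, i)) summable_on UNIV \<times> I" using assms by simp
  show "\<forall>k. (\<lambda>i. f (k, i)) summable_on I"
    using summable_on_SigmaD1[OF f] by auto
  have "(\<lambda>k. \<Sum>\<^sub>\<infinity>i\<in>I. f (k, i)) summable_on UNIV"
    using summable_on_Sigma_banach[OF f] by simp
  then have s: "((\<lambda>k. \<Sum>\<^sub>\<infinity>i\<in>I. f (k, i)) has_sum infsum f (UNIV \<times> I)) UNIV"
    using infsum_Sigma'_banach[OF f] has_sum_infsum by fastforce
  show "summable (\<lambda>k. \<Sum>\<^sub>\<infinity>i\<in>I. f (k, i))"
    and "infsum f (UNIV \<times> I) = (\<Sum>k. \<Sum>\<^sub>\<infinity>i\<in>I. f (k, i))"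
    using has_sum_imp_sums[OF s] by (auto simp: sums_iff)
qed

subsection \<open>Orbits of the dependence steps\<close>

locale multipliers =
  fixes p1 p2 :: nat
  assumes p1: "2 \<le> p1" and p2: "2 \<le> p2"
begin

definition multiplier :: "gen \<Rightarrow> nat" where
  "multiplier m = (case m of F1 \<Rightarrow> p1 | F2 \<Rightarrow> p2)"

lemma multiplier_ge_2: "2 \<le> multiplier m"
  using p1 p2 by (simp add: multiplier_def split: gen.split)

lemma multiplier_not_dvd_1: "\<not> multiplier m dvd 1"
  using multiplier_ge_2[of m] by auto

abbreviation step :: "gen \<Rightarrow> gen list \<Rightarrow> gen list" where
  "step \<equiv> mult_step p1 p2"

lemma step_eq: "step m h = h @ replicate ((multiplier m - 1) * tau m h) m"
  by (simp add: mult_step_def multiplier_def)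

lemma step_count_pos: "0 < (multiplier m - 1) * tau m h"
  using multiplier_ge_2[of m] tau_pos[of m h] by simp

lemma tau_step: "tau m (step m h) = multiplier m * tau m h"
proof -
  have "tau m (step m h) = (1 + (multiplier m - 1)) * tau m h"
    by (simp add: step_eq tau_append_replicate algebra_simps)
  then show ?thesis using multiplier_ge_2[of m] by simp
qed

lemma tau_step_other: "u \<noteq> m \<Longrightarrow> tau u (step m h) = 1"
  using tau_append_replicate_other step_count_pos by (simp add: step_eq)

lemma length_step: "length h < length (step m h)"
  using step_count_pos by (simp add: step_eq)

text \<open>A step multiplies the position on its own line by the multiplier and resets the other
  position to 1. Divisibility therefore reveals which step was taken last.\<close>

lemma dvd_tau_step_iff: "multiplier u dvd tau u (step m h) \<longleftrightarrow> u = m"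
  using tau_step tau_step_other multiplier_not_dvd_1 by (cases "u = m") auto

text \<open>Divisibility recovers the direction, the new position then recovers the old one, and
  this fixes how many letters were appended.\<close>

lemma step_inject: "step m h = step m' h' \<longleftrightarrow> m = m' \<and> h = h'"
proof
  assume eq: "step m h = step m' h'"
  then have m: "m = m'" using dvd_tau_step_iff by metis
  then have "multiplier m * tau m h = multiplier m * tau m h'" using eq tau_step by metis
  then have "tau m h = tau m h'" using multiplier_ge_2[of m] by auto
  then show "m = m' \<and> h = h'" using eq m by (simp add: step_eq)
qed simp

text \<open>Position \<open>t\<close> on the line starting at \<open>v\<close> is \<open>v\<close>
  followed by \<open>t - 1\<close> letters; hence the shifts by one.\<close>

lemma step_append_replicate:
  assumes "tau m v = 1" "1 \<le> t"
  shows "step m (v @ replicate (t - 1) m) = v @ replicate (multiplier m * t - 1) m"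
proof -
  have "tau m (v @ replicate (t - 1) m) = t" using assms by (simp add: tau_append_replicate)
  then have "step m (v @ replicate (t - 1) m)
      = v @ replicate ((t - 1) + (multiplier m - 1) * t) m"
    by (simp only: step_eq append_assoc replicate_add)
  also have "(t - 1) + (multiplier m - 1) * t = multiplier m * t - 1"
    using assms(2) multiplier_ge_2[of m] by (cases "multiplier m"; cases t) auto
  finally show ?thesis .
qed

text \<open>The preimage sits on the same line, at the position of \<open>h\<close> divided by the
  multiplier.\<close>

lemma dvd_tau_imp_step:
  assumes "multiplier m dvd tau m h"
  obtains h' where "h = step m h'"
proof -
  obtain t where t: "tau m h = multiplier m * t" using assms by (elim dvdE)
  have t0: "0 < t" using t tau_pos[of m h] by (cases t) auto
  obtain v where v: "h = v @ replicate (tau m h - 1) m" "v = [] \<or> m \<noteq> last v"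
    by (rule tau_decomp)
  have v1: "tau m v = 1" using v(2) tau_eq_1_iff by blast
  have "step m (v @ replicate (t - 1) m) = v @ replicate (tau m h - 1) m"
    using step_append_replicate[OF v1] t t0 by simp
  then show ?thesis using v(1) that by metis
qed

text \<open>By \<open>dvd_tau_step_iff\<close> and \<open>dvd_tau_imp_step\<close>, these are the
  vertices outside the ranges of both steps.\<close>

definition orbit_root :: "gen list \<Rightarrow> bool" where
  "orbit_root g \<longleftrightarrow> (\<forall>m. \<not> multiplier m dvd tau m g)"

lemma orbit_root_Nil: "orbit_root []"
  using multiplier_not_dvd_1 by (simp add: orbit_root_def)

lemma orbit_root_axis:
  assumes "tau m g \<noteq> 1" "\<not> multiplier m dvd tau m g"
  shows "orbit_root g"
  unfolding orbit_root_def using assms tau_other multiplier_not_dvd_1 by metis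

lemma orbit_root_not_step: "orbit_root g \<Longrightarrow> g \<noteq> step m h"
  using dvd_tau_step_iff by (auto simp: orbit_root_def)

text \<open>\<open>orb g\<close> labels the orbit of \<open>g\<close> by a copy of the tree: the
  word \<open>w\<close> records the steps taken.\<close>

definition orb :: "gen list \<Rightarrow> gen list \<Rightarrow> gen list" where
  "orb g w = fold step w g"

lemma orb_Nil [simp]: "orb g [] = g"
  by (simp add: orb_def)

lemma orb_snoc [simp]: "orb g (w @ [u]) = step u (orb g w)"
  by (simp add: orb_def)

text \<open>Lines in the labelling tree become iterates of one step; this turns multiplicative
  constraints into ordinary ones.\<close>

lemma orb_append_replicate: "orb g (w @ replicate j m) = (step m ^^ j) (orb g w)"
proof (induction j)
  case (Suc j)
  have "w @ replicate (Suc j) m = (w @ replicate j m) @ [m]"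
    by (simp add: replicate_append_same)
  then show ?case using Suc.IH by (simp only: orb_snoc) simp
qed simp

lemma length_orb: "length g + length w \<le> length (orb g w)"
proof (induction w rule: rev_induct)
  case (snoc u w)
  then show ?case using length_step[of "orb g w" u] by simp
qed simp

text \<open>Freeness of the orbits: equal endpoints have the same last step, so steps can be
  stripped in parallel until a root, which is no step, is reached.\<close>

lemma orb_inject:
  assumes "orbit_root g" "orbit_root g'"
  shows "orb g w = orb g' w' \<longleftrightarrow> g = g' \<and> w = w'"
proof
  show "orb g w = orb g' w' \<Longrightarrow> g = g' \<and> w = w'"
  proof (induction w arbitrary: w' rule: rev_induct)
    case Nil
    then show ?case using orbit_root_not_step[OF assms(1)] by (cases w' rule: rev_cases) auto
  next
    case (snoc u w)
    then have "w' \<noteq> []" using orbit_root_not_step[OF assms(2)] by (metis orb_Nil orb_snoc)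
    then obtain v u' where w': "w' = v @ [u']" by (metis rev_exhaust)
    then show ?case using snoc by (auto simp: step_inject)
  qed
qed simp

text \<open>Undoing a step shortens the word, so the process ends at a root.\<close>

lemma orb_surj: obtains g w where "orbit_root g" "h = orb g w"
proof -
  have "\<exists>g w. orbit_root g \<and> h = orb g w"
  proof (induction h rule: length_induct)
    case (1 h)
    show ?case
    proof (cases "orbit_root h")
      case True
      then show ?thesis by (intro exI[of _ h] exI[of _ "[]"]) simp
    next
      case False
      then obtain m h' where h: "h = step m h'"
        unfolding orbit_root_def using dvd_tau_imp_step by metis
      then obtain g w where "orbit_root g" "h' = orb g w" using 1 length_step by blast
      then show ?thesis using h by (intro exI[of _ g] exI[of _ "w @ [m]"]) simp
    qed
  qed
  then show ?thesis using that by blast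
qed

lemma dvd_tau_orb_iff:
  assumes "orbit_root g"
  shows "multiplier m dvd tau m (orb g w) \<longleftrightarrow> w \<noteq> [] \<and> last w = m"
  using assms by (cases w rule: rev_cases) (auto simp: dvd_tau_step_iff orbit_root_def)

definition roots :: "nat \<Rightarrow> gen list set" where
  "roots n = {g. orbit_root g \<and> length g \<le> n}"

lemma finite_roots: "finite (roots n)"
  by (rule finite_subset[OF _ finite_Delta[of n]]) (auto simp: roots_def Delta_def)

lemma reshaped_at_eq: "reshaped_at p1 p2 g k = {w. length (orb g w) \<le> length g + k}"
  by (simp add: reshaped_at_def orb_def)

lemma finite_reshaped_at: "finite (reshaped_at p1 p2 g k)"
proof (rule finite_subset[OF _ finite_Delta[of k]])
  have "length w \<le> k" if "length (orb g w) \<le> length g + k" for w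
    using length_orb[of g w] that by linarith
  then show "reshaped_at p1 p2 g k \<subseteq> Delta k" by (auto simp: reshaped_at_eq Delta_def)
qed

lemma finite_reshaped: "finite (reshaped p1 p2 t k)"
  by (simp add: reshaped_def finite_reshaped_at)

text \<open>The orbit of \<open>g\<close> meets \<open>Delta n\<close> in the labels with
  \<open>length (orb g w) \<le> length g + k\<close> for \<open>k = n - length g\<close>, which is
  the reshaped set for that \<open>k\<close>.\<close>

lemma orbits_Delta:
  "bij_betw (\<lambda>(g, w). orb g w) (SIGMA g:roots n. reshaped_at p1 p2 g (n - length g)) (Delta n)"
proof (rule bij_betw_imageI)
  show "inj_on (\<lambda>(g, w). orb g w) (SIGMA g:roots n. reshaped_at p1 p2 g (n - length g))"
    by (auto simp: inj_on_def roots_def orb_inject)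
  show "(\<lambda>(g, w). orb g w) ` (SIGMA g:roots n. reshaped_at p1 p2 g (n - length g)) = Delta n"
  proof (intro set_eqI iffI)
    fix h assume h: "h \<in> Delta n"
    obtain g w where gw: "orbit_root g" "h = orb g w" by (rule orb_surj)
    then have "length g \<le> n" "length h \<le> n"
      using h length_orb[of g w] by (auto simp: Delta_def)
    then show "h \<in> (\<lambda>(g, w). orb g w) ` (SIGMA g:roots n. reshaped_at p1 p2 g (n - length g))"
      using gw by (intro image_eqI[of _ _ "(g, w)"]) (auto simp: roots_def reshaped_at_eq)
  qed (auto simp: roots_def reshaped_at_eq Delta_def)
qed

lemma sum_card_reshaped:
  "(\<Sum>g\<in>roots n. real (card (reshaped p1 p2 (vertex_type g) (n - length g)))) = 2 ^ (n + 1) - 1"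
proof -
  have "(\<Sum>g\<in>roots n. card (reshaped_at p1 p2 g (n - length g))) = card (Delta n)"
    using bij_betw_same_card[OF orbits_Delta] finite_roots finite_reshaped_at by simp
  then show ?thesis using card_Delta by (simp add: reshaped_eq flip: of_nat_sum)
qed

end

subsection \<open>Counting patterns orbit by orbit\<close>

locale mult_product = multipliers +
  fixes \<Omega>1 \<Omega>2 :: "(nat \<Rightarrow> 'a::finite) set"
  assumes \<Omega>1: "subshift \<Omega>1" and \<Omega>2: "subshift \<Omega>2"
begin

definition factor :: "gen \<Rightarrow> (nat \<Rightarrow> 'a) set" where
  "factor m = (case m of F1 \<Rightarrow> \<Omega>1 | F2 \<Rightarrow> \<Omega>2)"

abbreviation Y :: "(gen list \<Rightarrow> 'a) set" where
  "Y \<equiv> axial_product \<Omega>1 \<Omega>2"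

abbreviation Z :: "(gen list \<Rightarrow> 'a) set" where
  "Z \<equiv> axial_mult_product (mult_subshift p1 \<Omega>1) (mult_subshift p2 \<Omega>2)"

text \<open>The multiplicative product constrains chains of steps from their first vertex, while
  \<open>Y\<close> constrains lines from every vertex; shift invariance bridges the gap.\<close>

lemma factor_shift: "s \<in> factor m \<Longrightarrow> (\<lambda>j. s (b + j)) \<in> factor m"
proof (induction b)
  case (Suc b)
  then have "(\<lambda>j. s (b + j)) \<in> factor m" by blast
  moreover have "\<forall>x\<in>factor m. (\<lambda>n. x (Suc n)) \<in> factor m"
    using \<Omega>1 \<Omega>2 by (cases m) (auto simp: subshift_def factor_def)
  ultimately show ?case by fastforce
qed simp

lemma mem_Y_iff: "y \<in> Y \<longleftrightarrow> (\<forall>w m. (\<lambda>j. y (w @ replicate j m)) \<in> factor m)"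
  by (simp add: axial_product_def factor_def)

lemma funpow_step:
  assumes "v = [] \<or> m \<noteq> last v" "1 \<le> i"
  shows "(step m ^^ l) (v @ replicate (i - 1) m) = v @ replicate (i * multiplier m ^ l - 1) m"
proof (induction l)
  case (Suc l)
  define t where "t = i * multiplier m ^ l"
  have t: "1 \<le> t" using assms(2) multiplier_ge_2[of m] by (simp add: t_def)
  have "tau m v = 1" using assms(1) tau_eq_1_iff by blast
  from step_append_replicate[OF this t] show ?case
    using Suc.IH by (simp add: t_def mult_ac)
qed simp

text \<open>A line start together with an index \<open>i\<close> not divisible by the multiplier is
  the same datum as the vertex \<open>h\<close> at position \<open>i\<close> of that line. By
  \<open>funpow_step\<close>, iterating the step from \<open>h\<close> visits the positions
  \<open>i * multiplier m ^ l\<close>.\<close>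

lemma mem_Z_iff_step:
  "x \<in> Z \<longleftrightarrow> (\<forall>h m. \<not> multiplier m dvd tau m h \<longrightarrow> (\<lambda>l. x ((step m ^^ l) h)) \<in> factor m)"
proof -
  have "x \<in> Z \<longleftrightarrow> (\<forall>g m. (g = [] \<or> m \<noteq> last g) \<longrightarrow>
    (\<forall>i\<ge>1. \<not> multiplier m dvd i \<longrightarrow>
      (\<lambda>l. x (g @ replicate (i * multiplier m ^ l - 1) m)) \<in> factor m))" (is "_ \<longleftrightarrow> ?R")
    unfolding axial_mult_product_def mem_Collect_eq
    by (intro iff_allI imp_cong refl)
      (auto simp: mult_subshift_def multiplier_def factor_def split: gen.split)
  also have "?R \<longleftrightarrow>
    (\<forall>h m. \<not> multiplier m dvd tau m h \<longrightarrow> (\<lambda>l. x ((step m ^^ l) h)) \<in> factor m)" (is "_ \<longleftrightarrow> ?S")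
  proof
    assume R: ?R
    show ?S
    proof (intro allI impI)
      fix h m assume nd: "\<not> multiplier m dvd tau m h"
      obtain v where v: "h = v @ replicate (tau m h - 1) m" "v = [] \<or> m \<noteq> last v"
        by (rule tau_decomp)
      have i: "1 \<le> tau m h" using tau_pos[of m h] by simp
      have "(step m ^^ l) h = v @ replicate (tau m h * multiplier m ^ l - 1) m" for l
        using funpow_step[OF v(2) i] v(1) by metis
      moreover have "(\<lambda>l. x (v @ replicate (tau m h * multiplier m ^ l - 1) m)) \<in> factor m"
        using R v(2) i nd by blast
      ultimately show "(\<lambda>l. x ((step m ^^ l) h)) \<in> factor m" by (simp only:)
    qed
  next
    assume S: ?S
    show ?R
    proof (intro allI impI)
      fix g m and i :: nat
      assume g: "g = [] \<or> m \<noteq> last g" and i: "1 \<le> i" "\<not> multiplier m dvd i"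
      have "tau m g = 1" using g tau_eq_1_iff by blast
      then have "tau m (g @ replicate (i - 1) m) = i" using i(1) by (simp add: tau_append_replicate)
      then have "(\<lambda>l. x ((step m ^^ l) (g @ replicate (i - 1) m))) \<in> factor m"
        using S i(2) by simp
      then show "(\<lambda>l. x (g @ replicate (i * multiplier m ^ l - 1) m)) \<in> factor m"
        by (simp only: funpow_step[OF g i(1)])
    qed
  qed
  finally show ?thesis .
qed

lemma mem_Z_iff: "x \<in> Z \<longleftrightarrow> (\<forall>g. orbit_root g \<longrightarrow> (\<lambda>w. x (orb g w)) \<in> Y)"
proof
  assume x: "x \<in> Z"
  show "\<forall>g. orbit_root g \<longrightarrow> (\<lambda>w. x (orb g w)) \<in> Y"
    unfolding mem_Y_iff
  proof (intro allI impI)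
    fix g w m assume g: "orbit_root g"
    define b where "b = tau m w - 1"
    obtain v where v: "w = v @ replicate b m" "v = [] \<or> m \<noteq> last v"
      unfolding b_def by (rule tau_decomp)
    \<comment> \<open>Since \<open>v\<close> does not end in \<open>m\<close>, its image begins a
      chain of steps in direction \<open>m\<close>; shifting that chain by \<open>b\<close> starts
      it at the image of \<open>w\<close>.\<close>
    have "\<not> multiplier m dvd tau m (orb g v)" using v(2) g by (auto simp: dvd_tau_orb_iff)
    then have "(\<lambda>l. x ((step m ^^ l) (orb g v))) \<in> factor m" using x mem_Z_iff_step by blast
    from factor_shift[OF this, of b]
    have "(\<lambda>j. x (orb g (v @ replicate (b + j) m))) \<in> factor m"
      by (simp only: orb_append_replicate)
    then show "(\<lambda>j. x (orb g (w @ replicate j m))) \<in> factor m"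
      using v(1) by (simp add: replicate_add)
  qed
next
  assume Y: "\<forall>g. orbit_root g \<longrightarrow> (\<lambda>w. x (orb g w)) \<in> Y"
  show "x \<in> Z"
    unfolding mem_Z_iff_step
  proof (intro allI impI)
    fix h m
    obtain g w where gw: "orbit_root g" "h = orb g w" by (rule orb_surj)
    then have "(\<lambda>w. x (orb g w)) \<in> Y" using Y by blast
    then have "(\<lambda>j. x (orb g (w @ replicate j m))) \<in> factor m" by (simp add: mem_Y_iff)
    then show "(\<lambda>l. x ((step m ^^ l) h)) \<in> factor m"
      using gw(2) by (simp add: orb_append_replicate)
  qed
qed

text \<open>The orbits partition the tree, so configurations on different orbits can be chosen
  independently.\<close>

lemma glue:
  assumes "\<And>g. orbit_root g \<Longrightarrow> y g \<in> Y"
  obtains x where "x \<in> Z" "\<And>g w. orbit_root g \<Longrightarrow> x (orb g w) = y g w"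
proof -
  define x where "x h = (case inv_into ({g. orbit_root g} \<times> UNIV) (\<lambda>(g, w). orb g w) h of
    (g, w) \<Rightarrow> y g w)" for h
  have "inj_on (\<lambda>(g, w). orb g w) ({g. orbit_root g} \<times> UNIV)"
    by (auto simp: inj_on_def orb_inject)
  then have x: "x (orb g w) = y g w" if "orbit_root g" for g w
    using inv_into_f_f[of "\<lambda>(g, w). orb g w" "{g. orbit_root g} \<times> UNIV" "(g, w)"] that
    by (simp add: x_def)
  then have "x \<in> Z" using assms by (simp add: mem_Z_iff cong: conj_cong)
  then show ?thesis using x that by blast
qed

text \<open>The map \<Phi> cuts a pattern into its pieces on the orbits. It is injective because the
  orbits cover \<open>Delta n\<close>, and onto the product by \<open>glue\<close>.\<close>

lemma card_patterns_Z:
  "card (patterns (Delta n) Z) =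
    (\<Prod>g\<in>roots n. card (patterns (reshaped p1 p2 (vertex_type g) (n - length g)) Y))"
proof -
  define R where "R g = reshaped_at p1 p2 g (n - length g)" for g
  define \<Phi> where "\<Phi> z = (\<lambda>g\<in>roots n. \<lambda>w\<in>R g. z (orb g w))" for z :: "gen list \<Rightarrow> 'a"
  have Delta: "orb g w \<in> Delta n" if "g \<in> roots n" "w \<in> R g" for g w
    using that bij_betwE[OF orbits_Delta] by (auto simp: R_def)
  have "bij_betw \<Phi> (patterns (Delta n) Z) (\<Pi>\<^sub>E g\<in>roots n. patterns (R g) Y)"
  proof (rule bij_betw_imageI)
    show "inj_on \<Phi> (patterns (Delta n) Z)"
    proof (rule inj_onI)
      fix z z' assume z: "z \<in> patterns (Delta n) Z" "z' \<in> patterns (Delta n) Z"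
        and eq: "\<Phi> z = \<Phi> z'"
      show "z = z'"
      proof
        fix h show "z h = z' h"
        proof (cases "h \<in> Delta n")
          case True
          then have "h \<in> (\<lambda>(g, w). orb g w) ` (SIGMA g:roots n. R g)"
            using bij_betw_imp_surj_on[OF orbits_Delta[of n]] by (simp only: R_def)
          then obtain g w where gw: "g \<in> roots n" "w \<in> R g" "h = orb g w" by auto
          then show ?thesis using fun_cong[OF fun_cong[OF eq, of g], of w] by (simp add: \<Phi>_def)
        qed (use z in \<open>auto simp: patterns_def\<close>)
      qed
    qed
    show "\<Phi> ` patterns (Delta n) Z = (\<Pi>\<^sub>E g\<in>roots n. patterns (R g) Y)"
    proof (intro set_eqI iffI)
      fix F assume "F \<in> \<Phi> ` patterns (Delta n) Z"
      then obtain x where x: "x \<in> Z" "F = \<Phi> (restrict x (Delta n))"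
        by (auto simp: patterns_def)
      have "F g = restrict (\<lambda>w. x (orb g w)) (R g)" if "g \<in> roots n" for g
        using that Delta by (auto simp: x(2) \<Phi>_def restrict_def)
      moreover have "(\<lambda>w. x (orb g w)) \<in> Y" if "g \<in> roots n" for g
        using that x(1) by (simp add: mem_Z_iff roots_def)
      ultimately have "F g \<in> patterns (R g) Y" if "g \<in> roots n" for g
        using that unfolding patterns_def by blast
      moreover have "F \<in> extensional (roots n)" by (simp add: x(2) \<Phi>_def)
      ultimately show "F \<in> (\<Pi>\<^sub>E g\<in>roots n. patterns (R g) Y)" by (auto simp: PiE_def)
    next
      fix F assume F: "F \<in> (\<Pi>\<^sub>E g\<in>roots n. patterns (R g) Y)"
      then have "\<forall>g\<in>roots n. \<exists>y. y \<in> Y \<and> F g = restrict y (R g)"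
        by (auto simp: patterns_def dest!: PiE_mem)
      then obtain y where y: "\<And>g. g \<in> roots n \<Longrightarrow> y g \<in> Y \<and> F g = restrict (y g) (R g)"
        by metis
      \<comment> \<open>The root \<open>[]\<close> is always present, so \<open>y []\<close> is a
        point of \<open>Y\<close> that can fill the orbits of roots longer than
        \<open>n\<close>.\<close>
      have Nil: "[] \<in> roots n" using orbit_root_Nil by (simp add: roots_def)
      obtain x where x: "x \<in> Z"
        "\<And>g w. orbit_root g \<Longrightarrow> x (orb g w) = (if g \<in> roots n then y g else y []) w"
        by (rule glue[of "\<lambda>g. if g \<in> roots n then y g else y []"]) (use y Nil in auto)
      have "F = \<Phi> (restrict x (Delta n))"
      proof
        fix g show "F g = \<Phi> (restrict x (Delta n)) g"
        proof (cases "g \<in> roots n")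
          case True
          then have "orbit_root g" by (simp add: roots_def)
          then show ?thesis using y[OF True] x(2)[of g] True Delta
            by (auto simp: \<Phi>_def restrict_def)
        qed (use F in \<open>auto simp: \<Phi>_def\<close>)
      qed
      then show "F \<in> \<Phi> ` patterns (Delta n) Z" using x(1) by (auto simp: patterns_def)
    qed
  qed
  then have "card (patterns (Delta n) Z) = card (\<Pi>\<^sub>E g\<in>roots n. patterns (R g) Y)"
    by (rule bij_betw_same_card)
  then show ?thesis by (simp add: card_PiE[OF finite_roots] R_def reshaped_eq)
qed

lemma ln_card_patterns_Z:
  "ln (real (card (patterns (Delta n) Z))) =
    (\<Sum>g\<in>roots n. ln (real (card (patterns (reshaped p1 p2 (vertex_type g) (n - length g)) Y))))"
proof (cases "Y = {}")
  \<comment> \<open>Every factor of the nonempty product is 0, and both sides vanish by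
    \<open>ln 0 = 0\<close>.\<close>
  case True
  then have "patterns \<Lambda> Y = {}" for \<Lambda> by (simp add: patterns_def)
  moreover have "roots n \<noteq> {}" using orbit_root_Nil by (auto simp: roots_def)
  ultimately show ?thesis using finite_roots by (simp add: card_patterns_Z power_0_left)
next
  case False
  then have "card (patterns (reshaped p1 p2 t k) Y) \<noteq> 0" for t k
    using finite_patterns(1)[OF finite_reshaped, where Z = Y]
    unfolding card_eq_0_iff by (auto simp: patterns_def)
  then show ?thesis using finite_roots by (simp add: card_patterns_Z ln_prod)
qed

end

subsection \<open>Counting roots by type\<close>

context multipliers
begin

definition axis_indices :: "gen \<Rightarrow> nat set" where
  "axis_indices m = {i. 1 < i \<and> \<not> multiplier m dvd i}"

text \<open>The terms of the double series with an arbitrary \<phi>: the same count is used for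
  logarithms of pattern numbers and for sizes of reshaped sets.\<close>

definition weight :: "(nat \<times> nat \<Rightarrow> nat \<Rightarrow> real) \<Rightarrow> gen \<Rightarrow> nat \<times> nat \<Rightarrow> real" where
  "weight \<phi> m = (\<lambda>(k, i). \<phi> (axis_type m i) k / 2 ^ (k + i + 1))"

definition partial :: "(nat \<times> nat \<Rightarrow> nat \<Rightarrow> real) \<Rightarrow> gen \<Rightarrow> nat \<Rightarrow> real" where
  "partial \<phi> m n = sum (weight \<phi> m) (triangle (axis_indices m) n)"

text \<open>Group the words by \<open>k = n - length g\<close> and \<open>i = tau m g\<close>. For
  \<open>k + i \<le> n\<close> the count is \<open>2 ^ (n + 1)\<close> times the factor
  \<open>1 / 2 ^ (k + i + 1)\<close> of \<open>weight\<close>; on the diagonal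
  \<open>k + i = n + 1\<close> it is twice that. Writing the diagonal as a difference of partial
  sums gives the formula.\<close>

lemma sum_roots_axis:
  "(\<Sum>g | length g \<le> n \<and> tau m g \<in> axis_indices m. \<phi> (vertex_type g) (n - length g)) =
    2 ^ (n + 1) * (2 * partial \<phi> m (n + 1) - partial \<phi> m n)"
proof -
  define S where "S = {g. length g \<le> n \<and> tau m g \<in> axis_indices m}"
  define T where "T = triangle (axis_indices m)"
  define D where "D = {(k, i). i \<in> axis_indices m \<and> k + i = n + 1}"
  have finS: "finite S"
    by (rule finite_subset[OF _ finite_Delta[of n]]) (auto simp: S_def Delta_def)
  have finT: "finite (T N)" for N by (simp add: T_def finite_triangle)
  have T_Suc: "T (n + 1) = T n \<union> D" and disj: "T n \<inter> D = {}"
    by (auto simp: T_def D_def triangle_def)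
  have finD: "finite D" using finT[of "n + 1"] unfolding T_Suc by simp
  have len: "tau m g \<le> length g + 1" for g
  proof -
    obtain v where "g = v @ replicate (tau m g - 1) m" by (rule tau_decomp)
    then have "length g = length v + (tau m g - 1)" by (metis length_append length_replicate)
    then show ?thesis by linarith
  qed
  have fiber: "(\<Sum>g | g \<in> S \<and> (n - length g, tau m g) = (k, i). \<phi> (vertex_type g) (n - length g))
      = real (if k + i = n + 1 then 1 else 2 ^ (n - k - i)) * \<phi> (axis_type m i) k"
    if ki: "(k, i) \<in> T (n + 1)" for k i
  proof -
    \<comment> \<open>Here \<open>2 \<le> i\<close> forces \<open>k < n\<close>, so the subtraction
      \<open>n - k\<close> is not truncated.\<close>
    have i: "2 \<le> i" "i \<in> axis_indices m" "k + i \<le> n + 1"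
      using ki by (auto simp: T_def triangle_def axis_indices_def)
    have eq: "{g. g \<in> S \<and> (n - length g, tau m g) = (k, i)} =
        {g. length g = n - k \<and> tau m g = i}"
      using i by (auto simp: S_def)
    have "(\<Sum>g | g \<in> S \<and> (n - length g, tau m g) = (k, i). \<phi> (vertex_type g) (n - length g))
      = (\<Sum>g | length g = n - k \<and> tau m g = i. \<phi> (axis_type m i) k)"
      unfolding eq using i by (intro sum.cong) (auto simp: vertex_type_axis[of m])
    also have "\<dots> = real (card {g. length g = n - k \<and> tau m g = i}) * \<phi> (axis_type m i) k"
      by simp
    also have "card {g. length g = n - k \<and> tau m g = i} =
        (if k + i = n + 1 then 1 else 2 ^ (n - k - i))"
      using i by (subst card_words_tau) auto
    finally show ?thesis .
  qed
  have "(\<Sum>g\<in>S. \<phi> (vertex_type g) (n - length g)) =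
    (\<Sum>y\<in>T (n + 1). \<Sum>g | g \<in> S \<and> (n - length g, tau m g) = y. \<phi> (vertex_type g) (n - length g))"
  proof (rule sum.group[symmetric, OF finS finT])
    have "n - length g + tau m g \<le> n + 1" if "length g \<le> n" for g
      using len[of g] that by linarith
    then show "(\<lambda>g. (n - length g, tau m g)) ` S \<subseteq> T (n + 1)"
      by (auto simp: S_def T_def triangle_def)
  qed
  also have "\<dots> = (\<Sum>(k, i)\<in>T (n + 1).
      real (if k + i = n + 1 then 1 else 2 ^ (n - k - i)) * \<phi> (axis_type m i) k)"
    by (intro sum.cong refl) (use fiber in \<open>auto simp del: of_nat_power\<close>)
  also have "\<dots> = (\<Sum>(k, i)\<in>T n.
        real (if k + i = n + 1 then 1 else 2 ^ (n - k - i)) * \<phi> (axis_type m i) k)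
      + (\<Sum>(k, i)\<in>D. real (if k + i = n + 1 then 1 else 2 ^ (n - k - i)) * \<phi> (axis_type m i) k)"
    unfolding T_Suc by (rule sum.union_disjoint[OF finT finD disj])
  also have "(\<Sum>(k, i)\<in>T n.
        real (if k + i = n + 1 then 1 else 2 ^ (n - k - i)) * \<phi> (axis_type m i) k)
      = 2 ^ (n + 1) * sum (weight \<phi> m) (T n)"
    unfolding sum_distrib_left
  proof (intro sum.cong refl, clarify)
    fix k i assume "(k, i) \<in> T n"
    then have ki: "k + i \<le> n" by (simp add: T_def triangle_def)
    then have "n + 1 = (n - k - i) + (k + i + 1)" by simp
    then have "(2::real) ^ (n + 1) = 2 ^ (n - k - i) * 2 ^ (k + i + 1)"
      by (metis power_add)
    then show "real (if k + i = n + 1 then 1 else 2 ^ (n - k - i)) * \<phi> (axis_type m i) k =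
        2 ^ (n + 1) * weight \<phi> m (k, i)"
      using ki by (simp add: weight_def del: power_Suc)
  qed
  \<comment> \<open>On the diagonal the count 1 equals
    \<open>2 ^ (n + 2) / 2 ^ (k + i + 1)\<close>.\<close>
  also have "(\<Sum>(k, i)\<in>D. real (if k + i = n + 1 then 1 else 2 ^ (n - k - i)) * \<phi> (axis_type m i) k)
      = 2 ^ (n + 2) * sum (weight \<phi> m) D"
    unfolding sum_distrib_left
    by (intro sum.cong refl, clarify) (simp add: D_def weight_def)
  also have "sum (weight \<phi> m) D = partial \<phi> m (n + 1) - partial \<phi> m n"
  proof -
    have "sum (weight \<phi> m) (T (n + 1)) = sum (weight \<phi> m) (T n) + sum (weight \<phi> m) D"
      unfolding T_Suc by (rule sum.union_disjoint[OF finT finD disj])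
    then show ?thesis by (simp add: partial_def T_def)
  qed
  finally show ?thesis
    by (simp add: S_def T_def partial_def[of \<phi> m n, symmetric] algebra_simps)
qed

text \<open>A nonempty root belongs to the axis of its last letter; only \<open>[]\<close> has type
  \<open>(1, 1)\<close>.\<close>

lemma sum_roots:
  "(\<Sum>g\<in>roots n. \<phi> (vertex_type g) (n - length g)) =
    \<phi> (1, 1) n + 2 ^ (n + 1) * (\<Sum>m\<in>UNIV. 2 * partial \<phi> m (n + 1) - partial \<phi> m n)"
proof -
  define S where "S m = {g. length g \<le> n \<and> tau m g \<in> axis_indices m}" for m
  have fin: "finite (S m)" for m
    by (rule finite_subset[OF _ finite_Delta[of n]]) (auto simp: S_def Delta_def)
  have "roots n = insert [] (S F1 \<union> S F2)"
  proof (intro set_eqI iffI)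
    fix g assume g: "g \<in> roots n"
    show "g \<in> insert [] (S F1 \<union> S F2)"
    proof (cases "g = []")
      case False
      then have "tau (last g) g \<noteq> 1" using tau_eq_1_iff by blast
      then have "g \<in> S (last g)"
        using g tau_pos[of "last g" g] by (auto simp: S_def roots_def orbit_root_def axis_indices_def)
      then show ?thesis by (cases "last g") auto
    qed simp
  next
    fix g assume "g \<in> insert [] (S F1 \<union> S F2)"
    then have "g = [] \<or> (\<exists>m. g \<in> S m)" by auto
    then show "g \<in> roots n"
    proof (elim disjE exE)
      fix m assume "g \<in> S m"
      then have "length g \<le> n" "tau m g \<noteq> 1" "\<not> multiplier m dvd tau m g"
        by (auto simp: S_def axis_indices_def)
      then show ?thesis using orbit_root_axis by (auto simp: roots_def)
    qed (simp add: roots_def orbit_root_Nil)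
  qed
  moreover have "S F1 \<inter> S F2 = {}"
    using tau_other[of F1 _ F2] by (force simp: S_def axis_indices_def)
  moreover have "[] \<notin> S F1 \<union> S F2" by (auto simp: S_def axis_indices_def)
  ultimately have "(\<Sum>g\<in>roots n. \<phi> (vertex_type g) (n - length g)) = \<phi> (1, 1) n +
      ((\<Sum>g\<in>S F1. \<phi> (vertex_type g) (n - length g)) +
       (\<Sum>g\<in>S F2. \<phi> (vertex_type g) (n - length g)))"
    using fin by (simp add: sum.union_disjoint vertex_type_def)
  then show ?thesis
    by (simp add: S_def sum_roots_axis UNIV_gen algebra_simps)
qed

section \<open>Sizes of the reshaped sets as dominating terms\<close>

definition reshaped_size :: "nat \<times> nat \<Rightarrow> nat \<Rightarrow> real" where
  "reshaped_size t k = real (card (reshaped p1 p2 t k))"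

lemma weight_nonneg: "(\<And>t k. 0 \<le> \<phi> t k) \<Longrightarrow> 0 \<le> weight \<phi> m z"
  by (auto simp: weight_def split: prod.split)

text \<open>Since the orbits fill \<^term>\<open>Delta n\<close>, the identity of \<open>sum_roots\<close> for \<open>\<phi> = reshaped_size\<close>
  bounds the partial sums by \<open>1\<close>.\<close>

lemma summable_weight_reshaped_size: "weight reshaped_size m summable_on UNIV \<times> axis_indices m"
proof (rule triangle_sums_bounded_summable)
  have nn: "0 \<le> weight reshaped_size u z" for u z
    by (rule weight_nonneg) (simp add: reshaped_size_def)
  then show "0 \<le> weight reshaped_size m z" for z .
  fix n
  have mono: "partial reshaped_size u N \<le> partial reshaped_size u (N + 1)" for u N
    unfolding partial_def using nn by (intro sum_mono2 finite_triangle) (auto simp: triangle_def)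
  have pos: "0 \<le> partial reshaped_size u N" for u N
    unfolding partial_def using nn by (simp add: sum_nonneg)
  define s where "s = (\<Sum>u\<in>UNIV. 2 * partial reshaped_size u (n + 1) - partial reshaped_size u n)"
  have "(2::real) ^ (n + 1) - 1 = reshaped_size (1, 1) n + 2 ^ (n + 1) * s"
    using sum_card_reshaped[of n] sum_roots[of reshaped_size n]
    by (simp only: reshaped_size_def[symmetric] s_def)
  moreover have "0 \<le> reshaped_size (1, 1) n" by (simp add: reshaped_size_def)
  ultimately have "(2::real) ^ (n + 1) * s \<le> 2 ^ (n + 1) * 1" by linarith
  then have "s \<le> 1" by (rule mult_left_le_imp_le) simp
  \<comment> \<open>Monotonicity and nonnegativity of \<open>partial\<close> make every summand of
    \<open>s\<close> nonnegative, so each is at most \<open>s\<close>; the summand for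
    \<open>m\<close> also dominates \<open>partial reshaped_size m n\<close>.\<close>
  moreover have "2 * partial reshaped_size m (n + 1) - partial reshaped_size m n \<le> s"
    unfolding s_def by (rule member_le_sum) (use mono pos in \<open>auto, smt (verit)\<close>)
  ultimately show "sum (weight reshaped_size m) (triangle (axis_indices m) n) \<le> 1"
    using mono[of m n] by (simp add: partial_def)
qed

text \<open>After one step on the \<open>m\<close>-line, the root \<open>[]\<close> and any vertex of \<open>m\<close>-position \<open>1\<close> have
  the same continuation.\<close>

lemma reshaped_at_Nil_subset:
  "reshaped_at p1 p2 [] n \<subseteq>
    {[]} \<union> reshaped_at p1 p2 (replicate p1 F1) n \<union> reshaped_at p1 p2 (replicate p2 F2) n"
proof
  fix w assume w: "w \<in> reshaped_at p1 p2 [] n"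
  have *: "w \<in> reshaped_at p1 p2 g n" if "w = m # w'" "tau m g = 1" for m w' g
  proof -
    have s: "step m g = g @ step m []" using that(2) by (simp add: step_eq)
    have "tau u (step m g) = tau u (step m [])" for u
      using that(2) by (cases "u = m") (simp_all add: tau_step tau_step_other)
    then have "vertex_type (step m g) = vertex_type (step m [])" by (rule vertex_type_eqI)
    then obtain v where "fold step w' (step m g) = step m g @ v"
      "fold step w' (step m []) = step m [] @ v"
      using fold_mult_step_cong by blast
    then show ?thesis using w that(1) s by (simp add: reshaped_at_def)
  qed
  \<comment> \<open>The roles cross: a label starting with \<open>F1\<close> is compared at the
    power of \<open>F2\<close>, where the \<open>F1\<close>-position is 1, and conversely.\<close>
  have other: "tau F2 (replicate p1 F1) = 1" "tau F1 (replicate p2 F2) = 1"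
    using tau_append_replicate_other[of _ _ _ "[]"] p1 p2 by simp_all
  show "w \<in> {[]} \<union> reshaped_at p1 p2 (replicate p1 F1) n \<union> reshaped_at p1 p2 (replicate p2 F2) n"
  proof (cases w)
    case (Cons m w')
    then show ?thesis using *[of m w'] other by (cases m) auto
  qed simp
qed

text \<open>Type \<open>(1, 1)\<close> does not occur in the summable series, so its size is
  compared with types that do: \<open>multiplier m + 1\<close> exceeds 1 and is not divisible by
  \<open>multiplier m\<close>.\<close>

lemma reshaped_size_Nil_le:
  "reshaped_size (1, 1) n \<le> 1 + (\<Sum>m\<in>UNIV. reshaped_size (axis_type m (multiplier m + 1)) n)"
proof -
  define R where "R m = reshaped_at p1 p2 (replicate (multiplier m) m) n" for m
  have R: "real (card (R m)) = reshaped_size (axis_type m (multiplier m + 1)) n" for m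
  proof -
    have "tau m (replicate (multiplier m) m) = multiplier m + 1"
      using tau_append_replicate[of m "[]"] by simp
    then have "vertex_type (replicate (multiplier m) m) = axis_type m (multiplier m + 1)"
      using vertex_type_axis[of m] multiplier_ge_2[of m] by simp
    then show ?thesis by (metis R_def reshaped_eq reshaped_size_def)
  qed
  have "reshaped_at p1 p2 [] n \<subseteq> {[]} \<union> R F1 \<union> R F2"
    using reshaped_at_Nil_subset by (simp add: R_def multiplier_def)
  then have "card (reshaped_at p1 p2 [] n) \<le> card ({[]} \<union> R F1 \<union> R F2)"
    by (rule card_mono[rotated]) (simp add: R_def finite_reshaped_at)
  also have "\<dots> \<le> 1 + card (R F1) + card (R F2)"
    using card_Un_le[of "{[]} \<union> R F1" "R F2"] card_Un_le[of "{[]}" "R F1"] by simp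
  finally have "real (card (reshaped_at p1 p2 [] n)) \<le> 1 + real (card (R F1)) + real (card (R F2))"
    by linarith
  moreover have "real (card (reshaped_at p1 p2 [] n)) = reshaped_size (1, 1) n"
    using reshaped_eq[of p1 p2 "[]" n] by (simp add: reshaped_size_def vertex_type_def)
  ultimately show ?thesis by (simp add: R UNIV_gen)
qed

text \<open>The bounding sizes, suitably weighted, form the column
  \<open>i = multiplier m + 1\<close> of a summable double series, so they tend to 0.\<close>

lemma reshaped_size_Nil_negligible: "(\<lambda>n. reshaped_size (1, 1) n / 2 ^ (n + 1)) \<longlonglongrightarrow> 0"
proof -
  have axis: "(\<lambda>n. reshaped_size (axis_type m (multiplier m + 1)) n / 2 ^ (n + 1)) \<longlonglongrightarrow> 0" for m
  proof -
    define i where "i = multiplier m + 1"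
    have "(\<lambda>k. weight reshaped_size m (k, i)) summable_on UNIV"
    proof -
      have "i \<in> axis_indices m"
        using multiplier_ge_2[of m] multiplier_not_dvd_1[of m]
        unfolding i_def axis_indices_def mem_Collect_eq dvd_add_triv_left_iff by linarith
      then have "weight reshaped_size m summable_on (\<lambda>k. (k, i)) ` UNIV"
        by (intro summable_on_subset_banach[OF summable_weight_reshaped_size]) auto
      moreover have "inj (\<lambda>k. (k, i))" by (auto simp: inj_on_def)
      ultimately show ?thesis
        using summable_on_reindex[of "\<lambda>k. (k, i)" UNIV "weight reshaped_size m"]
        by (simp add: o_def)
    qed
    then have "(\<lambda>k. weight reshaped_size m (k, i)) \<longlonglongrightarrow> 0"
      by (intro summable_LIMSEQ_zero summable_on_imp_summable)
    \<comment> \<open>The column index is fixed, so the factor \<open>2 ^ i\<close> in the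
      denominator of \<open>weight\<close> can be cancelled.\<close>
    from tendsto_mult_left[OF this, of "2 ^ i"] show ?thesis
      by (simp add: weight_def power_add i_def field_simps)
  qed
  have "(\<lambda>n. 1 / 2 ^ (n + 1) +
      (\<Sum>m\<in>UNIV. reshaped_size (axis_type m (multiplier m + 1)) n / 2 ^ (n + 1))) \<longlonglongrightarrow> 0 + (\<Sum>m\<in>(UNIV::gen set). 0)"
  proof (intro tendsto_add tendsto_sum axis)
    show "(\<lambda>n. 1 / 2 ^ (n + 1) :: real) \<longlonglongrightarrow> 0"
      using LIMSEQ_ignore_initial_segment[OF LIMSEQ_power_zero[of "1 / 2 :: real"], of 1]
      by (simp add: power_divide)
  qed
  then have lim: "(\<lambda>n. 1 / 2 ^ (n + 1) +
      (\<Sum>m\<in>UNIV. reshaped_size (axis_type m (multiplier m + 1)) n / 2 ^ (n + 1))) \<longlonglongrightarrow> 0"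
    by simp
  show ?thesis
  proof (rule tendsto_sandwich[OF _ _ tendsto_const lim])
    show "\<forall>\<^sub>F n in sequentially. 0 \<le> reshaped_size (1, 1) n / 2 ^ (n + 1)"
      by (simp add: reshaped_size_def)
    show "\<forall>\<^sub>F n in sequentially. reshaped_size (1, 1) n / 2 ^ (n + 1) \<le> 1 / 2 ^ (n + 1) +
      (\<Sum>m\<in>UNIV. reshaped_size (axis_type m (multiplier m + 1)) n / 2 ^ (n + 1))"
      using divide_right_mono[OF reshaped_size_Nil_le, of "2 ^ (_ + 1)"]
      by (intro always_eventually allI) (simp only: add_divide_distrib sum_divide_distrib, simp)
  qed
qed

text \<open>Divide \<open>sum_roots\<close> by \<open>card (Delta n)\<close>, which is asymptotic to
  \<open>2 ^ (n + 1)\<close>. The root \<open>[]\<close> drops out, and the triangular sums converge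
  by domination.\<close>

lemma root_averages_tendsto:
  assumes "\<And>t k. 0 \<le> \<phi> t k" "\<And>t k. \<phi> t k \<le> C * reshaped_size t k"
  shows "weight \<phi> m summable_on UNIV \<times> axis_indices m"
    and "(\<lambda>n. (\<Sum>g\<in>roots n. \<phi> (vertex_type g) (n - length g)) / real (card (Delta n)))
      \<longlonglongrightarrow> (\<Sum>m\<in>UNIV. infsum (weight \<phi> m) (UNIV \<times> axis_indices m))"
proof -
  have summ: "weight \<phi> m summable_on UNIV \<times> axis_indices m" for m
  proof (rule summable_on_comparison_test)
    show "(\<lambda>z. C * weight reshaped_size m z) summable_on UNIV \<times> axis_indices m"
      by (intro summable_on_cmult_right summable_weight_reshaped_size)
    show "weight \<phi> m z \<le> C * weight reshaped_size m z" for z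
      using assms(2) by (auto simp: weight_def divide_right_mono split: prod.split)
    show "0 \<le> weight \<phi> m z" for z using assms(1) by (rule weight_nonneg)
  qed
  then show "weight \<phi> m summable_on UNIV \<times> axis_indices m" .
  define L where "L m = infsum (weight \<phi> m) (UNIV \<times> axis_indices m)" for m
  have P: "partial \<phi> m \<longlonglongrightarrow> L m" for m
    unfolding partial_def L_def by (rule triangle_sums_tendsto[OF summ])
  have "(\<lambda>n. C * (reshaped_size (1, 1) n / 2 ^ (n + 1))) \<longlonglongrightarrow> 0"
    using tendsto_mult_left[OF reshaped_size_Nil_negligible, of C] by simp
  then have "(\<lambda>n. \<phi> (1, 1) n / 2 ^ (n + 1)) \<longlonglongrightarrow> 0"
    by (rule tendsto_sandwich[rotated 2, OF tendsto_const])
      (use assms divide_right_mono[OF assms(2), of "2 ^ (_ + 1)"] in auto)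
  \<comment> \<open>Both \<open>partial \<phi> m (n + 1)\<close> and
    \<open>partial \<phi> m n\<close> tend to \<open>L m\<close>, so the doubled diagonal disappears
    in the limit.\<close>
  moreover have "(\<lambda>n. \<Sum>m\<in>UNIV. 2 * partial \<phi> m (n + 1) - partial \<phi> m n)
      \<longlonglongrightarrow> (\<Sum>m\<in>UNIV. 2 * L m - L m)"
    by (intro tendsto_sum tendsto_diff tendsto_mult_left P LIMSEQ_ignore_initial_segment)
  ultimately have "(\<lambda>n. \<phi> (1, 1) n / 2 ^ (n + 1) +
      (\<Sum>m\<in>UNIV. 2 * partial \<phi> m (n + 1) - partial \<phi> m n)) \<longlonglongrightarrow> 0 + (\<Sum>m\<in>UNIV. 2 * L m - L m)"
    by (rule tendsto_add)
  moreover have "(\<lambda>n. 2 ^ (n + 1) / (2 ^ (n + 1) - 1) :: real) \<longlonglongrightarrow> 1"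
    by real_asymp
  ultimately have "(\<lambda>n. 2 ^ (n + 1) / (2 ^ (n + 1) - 1) * (\<phi> (1, 1) n / 2 ^ (n + 1) +
      (\<Sum>m\<in>UNIV. 2 * partial \<phi> m (n + 1) - partial \<phi> m n))) \<longlonglongrightarrow> 1 * (0 + (\<Sum>m\<in>UNIV. 2 * L m - L m))"
    by (rule tendsto_mult[rotated])
  moreover have "2 ^ (n + 1) / (2 ^ (n + 1) - 1) * (\<phi> (1, 1) n / 2 ^ (n + 1) +
      (\<Sum>m\<in>UNIV. 2 * partial \<phi> m (n + 1) - partial \<phi> m n)) =
      (\<Sum>g\<in>roots n. \<phi> (vertex_type g) (n - length g)) / real (card (Delta n))" for n
  proof -
    have scale: "(q::real) / d * (a / q + s) = (a + q * s) / d" if "q \<noteq> 0" for q d a s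
    proof -
      have "q * (a / q + s) = a + q * s" using that by (simp add: distrib_left)
      then show ?thesis by (metis times_divide_eq_left)
    qed
    show ?thesis unfolding sum_roots card_Delta by (rule scale) simp
  qed
  ultimately show "(\<lambda>n. (\<Sum>g\<in>roots n. \<phi> (vertex_type g) (n - length g)) / real (card (Delta n)))
      \<longlonglongrightarrow> (\<Sum>m\<in>UNIV. infsum (weight \<phi> m) (UNIV \<times> axis_indices m))"
    by (simp add: L_def)
qed

end

section \<open>The entropy formula\<close>

theorem theorem3p5:
  fixes \<Omega>1 \<Omega>2 :: "(nat \<Rightarrow> 'a::finite) set" and p1 p2 :: nat
  assumes "subshift \<Omega>1" and "subshift \<Omega>2" and "p1 \<ge> 2" and "p2 \<ge> 2"
  defines "Z \<equiv> axial_mult_product (mult_subshift p1 \<Omega>1) (mult_subshift p2 \<Omega>2)"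
    and "c1 \<equiv> \<lambda>k i. 1 / 2 ^ (k + i + 1) *
           ln (real (card (patterns (reshaped p1 p2 (i, 1) k) (axial_product \<Omega>1 \<Omega>2))))"
    and "c2 \<equiv> \<lambda>k j. 1 / 2 ^ (k + j + 1) *
           ln (real (card (patterns (reshaped p1 p2 (1, j) k) (axial_product \<Omega>1 \<Omega>2))))"
    and "I1 \<equiv> {i::nat. i > 1 \<and> \<not> p1 dvd i}"
    and "I2 \<equiv> {j::nat. j > 1 \<and> \<not> p2 dvd j}"
  shows "convergent (entropy_ratio Z) \<and>
    (\<forall>k. c1 k summable_on I1) \<and> summable (\<lambda>k. \<Sum>\<^sub>\<infinity>i\<in>I1. c1 k i) \<and>
    (\<forall>k. c2 k summable_on I2) \<and> summable (\<lambda>k. \<Sum>\<^sub>\<infinity>j\<in>I2. c2 k j) \<and>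
    tree_entropy Z = (\<Sum>k. \<Sum>\<^sub>\<infinity>i\<in>I1. c1 k i) + (\<Sum>k. \<Sum>\<^sub>\<infinity>j\<in>I2. c2 k j)"
proof -
  interpret mult_product p1 p2 \<Omega>1 \<Omega>2
    using assms by unfold_locales
  define \<phi> where "\<phi> t k = ln (real (card (patterns (reshaped p1 p2 t k) (axial_product \<Omega>1 \<Omega>2))))"
    for t k
  \<comment> \<open>The domination constant is the logarithm of the alphabet size.\<close>
  have \<phi>: "0 \<le> \<phi> t k" "\<phi> t k \<le> ln (real CARD('a)) * reshaped_size t k" for t k
    unfolding \<phi>_def reshaped_size_def by (rule ln_card_patterns_le[OF finite_reshaped])+
  note summ = root_averages_tendsto(1)[of \<phi>, OF \<phi>]
  note lim = root_averages_tendsto(2)[of \<phi>, OF \<phi>]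
  have I: "axis_indices F1 = I1" "axis_indices F2 = I2"
    by (simp_all add: axis_indices_def I1_def I2_def multiplier_def)
  have c: "(\<lambda>i. weight \<phi> F1 (k, i)) = c1 k" "(\<lambda>i. weight \<phi> F2 (k, i)) = c2 k" for k
    by (simp_all add: weight_def \<phi>_def axis_type_def c1_def c2_def)
  have "entropy_ratio Z =
      (\<lambda>n. (\<Sum>g\<in>roots n. \<phi> (vertex_type g) (n - length g)) / real (card (Delta n)))"
    by (simp add: fun_eq_iff entropy_ratio_def Z_def ln_card_patterns_Z \<phi>_def)
  then have ratio: "entropy_ratio Z \<longlonglongrightarrow> (\<Sum>k. \<Sum>\<^sub>\<infinity>i\<in>I1. c1 k i) + (\<Sum>k. \<Sum>\<^sub>\<infinity>j\<in>I2. c2 k j)"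
    using lim summable_iterated(3)[OF summ[of F1]] summable_iterated(3)[OF summ[of F2]]
    by (simp add: UNIV_gen I c)
  then have "convergent (entropy_ratio Z)"
    "tree_entropy Z = (\<Sum>k. \<Sum>\<^sub>\<infinity>i\<in>I1. c1 k i) + (\<Sum>k. \<Sum>\<^sub>\<infinity>j\<in>I2. c2 k j)"
    by (auto simp: convergent_def tree_entropy_def limI)
  then show ?thesis
    using summable_iterated(1,2)[OF summ[of F1]] summable_iterated(1,2)[OF summ[of F2]]
    by (simp add: I c)
qed

end
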